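(* Let $f$ be a superquadratic function defined on an interval $I=[0,a]$ or $I=[0,\infty)$, let $x_1,\dots,x_n\in I$, let $p_1,\dots,p_n\in(0,1)$ be such that $\sum_{i=1}^n p_i=1$, and let $\lambda\in[0,1]$. Then $$\sum_{i=1}^{n}p_{i}f\Big((1-\lambda)\sum_{j=1}^{n}p_{j}x_{j}+\lambda x_{i}\Big)-f\Big(\sum_{j=1}^{n}p_{j}x_{j}\Big)\geq \sum_{i=1}^{n}p_{i}f\Big(\lambda\Big|x_{i}-\sum_{j=1}^{n}p_{j}x_{j}\Big|\Big).$$
   Context: A function $f:I\to\mathbb{R}$ on an interval $I=[0,a]$ or $I=[0,\infty)$ is superquadratic if for each $x\in I$ there exists a real number $C(x)$ such that $f(y)-f(x)\geq f(|y-x|)+C(x)(y-x)$ for all $y\in I$. *)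

theory Defs
  imports Complex_Main
begin

text \<open>The set \<open>I\<close> is meant to be \<open>[0, a]\<close> or \<open>[0, \<infinity>)\<close>; then \<open>\<bar>y - x\<bar> \<in> I\<close> for all
  \<open>x, y \<in> I\<close>, so the values of \<open>f\<close> outside \<open>I\<close> are irrelevant.\<close>

definition superquadratic_on :: "real set \<Rightarrow> (real \<Rightarrow> real) \<Rightarrow> bool" where
  "superquadratic_on I f \<longleftrightarrow>
     (\<forall>x\<in>I. \<exists>C::real. \<forall>y\<in>I. f y - f x \<ge> f \<bar>y - x\<bar> + C * (y - x))"

end

theory Submission
  imports Defs "HOL-Analysis.Convex"
begin

text \<open>
  A superquadratic function satisfies a refined Jensen inequality, whose gap is bounded below by
  the mean of \<open>f\<close> over the absolute deviations from the mean (\<open>superquadratic_jensen\<close>). It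
  follows by averaging over the given points the defining inequality with base point the mean.

  The theorem is this inequality at the contracted points \<open>(1 - \<lambda>) m + \<lambda> x\<^sub>i\<close>. Moving every point
  towards the mean by the same factor leaves the mean at \<open>m\<close>, keeps the points in the convex
  interval, and scales each deviation \<open>\<bar>x\<^sub>i - m\<bar>\<close> by \<open>\<lambda>\<close>.
\<close>

text \<open>Nothing is known about the slope \<open>C\<close> that superquadraticity provides at \<open>m\<close>, but after
  averaging it multiplies the mean of \<open>y i - m\<close>, which vanishes because \<open>m\<close> is the mean.\<close>

lemma superquadratic_jensen:
  fixes f :: "real \<Rightarrow> real" and y p :: "'i \<Rightarrow> real"
  assumes sq: "superquadratic_on I f"
    and y: "\<And>i. i \<in> A \<Longrightarrow> y i \<in> I"
    and p: "\<And>i. i \<in> A \<Longrightarrow> p i \<ge> 0"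
    and sum1: "(\<Sum>i\<in>A. p i) = 1"
    and mean: "(\<Sum>i\<in>A. p i * y i) = m"
    and m: "m \<in> I"
  shows "(\<Sum>i\<in>A. p i * f (y i)) - f m \<ge> (\<Sum>i\<in>A. p i * f \<bar>y i - m\<bar>)"
proof -
  obtain C where C: "\<And>z. z \<in> I \<Longrightarrow> f z - f m \<ge> f \<bar>z - m\<bar> + C * (z - m)"
    using sq m unfolding superquadratic_on_def by blast
  have "(\<Sum>i\<in>A. p i * (f \<bar>y i - m\<bar> + C * (y i - m))) \<le> (\<Sum>i\<in>A. p i * (f (y i) - f m))"
    by (intro sum_mono mult_left_mono C y p)
  moreover have "(\<Sum>i\<in>A. p i * (f (y i) - f m)) = (\<Sum>i\<in>A. p i * f (y i)) - f m"
    by (simp add: right_diff_distrib sum_subtractf sum1 flip: sum_distrib_right)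
  moreover have "(\<Sum>i\<in>A. p i * (f \<bar>y i - m\<bar> + C * (y i - m))) = (\<Sum>i\<in>A. p i * f \<bar>y i - m\<bar>)"
  proof -
    have "(\<Sum>i\<in>A. p i * (f \<bar>y i - m\<bar> + C * (y i - m)))
        = (\<Sum>i\<in>A. p i * f \<bar>y i - m\<bar>) + C * ((\<Sum>i\<in>A. p i * y i) - (\<Sum>i\<in>A. p i) * m)"
      by (simp add: algebra_simps sum.distrib sum_subtractf sum_distrib_left)
    then show ?thesis
      by (simp add: mean sum1)
  qed
  ultimately show ?thesis
    by simp
qed

theorem theorem4:
  fixes f :: "real \<Rightarrow> real" and I :: "real set" and n :: nat
    and x p :: "nat \<Rightarrow> real" and lam :: real
  assumes "(\<exists>a\<ge>0. I = {0..a}) \<or> I = {0..}"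
    and "superquadratic_on I f"
    and "\<And>i. i \<in> {1..n} \<Longrightarrow> x i \<in> I"
    and "\<And>i. i \<in> {1..n} \<Longrightarrow> p i \<in> {0<..<1}"
    and "(\<Sum>i=1..n. p i) = 1"
    and "lam \<in> {0..1}"
  shows "(\<Sum>i=1..n. p i * f ((1 - lam) * (\<Sum>j=1..n. p j * x j) + lam * x i))
           - f (\<Sum>j=1..n. p j * x j)
         \<ge> (\<Sum>i=1..n. p i * f (lam * \<bar>x i - (\<Sum>j=1..n. p j * x j)\<bar>))"
proof -
  define m where "m = (\<Sum>j=1..n. p j * x j)"
  define y where "y i = (1 - lam) * m + lam * x i" for i
  have conv: "convex I"
    using assms(1) by auto
  have m: "m \<in> I"
    using convex_sum[of "{1..n}" I p x] conv assms(3-5) by (force simp: m_def)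
  have y: "y i \<in> I" if "i \<in> {1..n}" for i
    using convexD[OF conv m assms(3)[OF that], of "1 - lam" lam] assms(6) by (simp add: y_def)
  have mean: "(\<Sum>i=1..n. p i * y i) = m"
  proof -
    have "(\<Sum>i=1..n. p i * y i)
        = (1 - lam) * m * (\<Sum>i=1..n. p i) + lam * (\<Sum>i=1..n. p i * x i)"
      by (simp add: y_def distrib_left sum.distrib sum_distrib_left mult_ac)
    then show ?thesis
      unfolding assms(5) m_def[symmetric] by (simp add: algebra_simps)
  qed
  have deviation: "\<bar>y i - m\<bar> = lam * \<bar>x i - m\<bar>" for i
  proof -
    have "y i - m = lam * (x i - m)"
      by (simp add: y_def algebra_simps)
    then show ?thesis
      using assms(6) by (simp add: abs_mult)
  qed
  have "(\<Sum>i=1..n. p i * f (y i)) - f m \<ge> (\<Sum>i=1..n. p i * f \<bar>y i - m\<bar>)"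
    using assms(4)
    by (intro superquadratic_jensen[OF assms(2) y _ assms(5) mean m]) (auto simp: less_imp_le)
  then show ?thesis
    unfolding deviation unfolding y_def m_def .
qed

end
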